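(* Let $f_1,f_2:\mathbb{R}^n\to\mathbb{R}\cup\{+\infty\}$ be proper, lower semicontinuous and prox-bounded with respective thresholds $r_1,r_2$. Define $f(x)=(f_1+f_2)(x)$. Then $f$ is prox-bounded with threshold $\bar r\le r_1+r_2$. Moreover, if $f_2$ is bounded (above and below), then $\bar r=r_1$.
   Context: $\mathbb{R}^n$ is equipped with an inner product and the induced norm $\|\cdot\|$. For $f:\mathbb{R}^n\to\mathbb{R}\cup\{+\infty\}$ and $r\ge 0$, the Moreau envelope of $f$ is $e_rf(x)=\inf_{y\in\mathbb{R}^n}\{f(y)+\frac r2\|y-x\|^2\}$. The function $f$ is prox-bounded if there exists $r\ge0$ such that $e_rf(x)>-\infty$ for some $x\in\mathbb{R}^n$; the infimum of all such $r\ge 0$ is called the threshold of prox-boundedness of $f$. Proper means not identically $+\infty$ and never $-\infty$. *)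

theory Defs
  imports "HOL-Analysis.Analysis"
begin

definition proper_fun :: "('a \<Rightarrow> ereal) \<Rightarrow> bool" where
  "proper_fun f \<longleftrightarrow> (\<exists>x. f x \<noteq> \<infinity>) \<and> (\<forall>x. f x \<noteq> -\<infinity>)"

definition lsc_fun :: "('a::topological_space \<Rightarrow> ereal) \<Rightarrow> bool" where
  "lsc_fun f \<longleftrightarrow> (\<forall>x. f x \<le> Liminf (at x) f)"

definition moreau_envelope :: "real \<Rightarrow> ('a::real_normed_vector \<Rightarrow> ereal) \<Rightarrow> 'a \<Rightarrow> ereal" where
  "moreau_envelope r f x = (INF y. f y + ereal (r / 2 * (norm (y - x))\<^sup>2))"

definition prox_bounded :: "('a::real_normed_vector \<Rightarrow> ereal) \<Rightarrow> bool" where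
  "prox_bounded f \<longleftrightarrow> (\<exists>r\<ge>0. \<exists>x. moreau_envelope r f x > -\<infinity>)"

(* The infimum is taken in the reals, so the value is meaningful only for prox-bounded f:
   the set is then nonempty, and it is bounded below by 0. *)
definition prox_threshold :: "('a::real_normed_vector \<Rightarrow> ereal) \<Rightarrow> real" where
  "prox_threshold f = Inf {r. r \<ge> 0 \<and> (\<exists>x. moreau_envelope r f x > -\<infinity>)}"

end

theory Submission
  imports Defs
begin

text \<open>
  The envelope \<open>moreau_envelope r f\<close> is finite from below at \<open>x\<close> exactly when \<open>f\<close> lies above a
  concave paraboloid \<open>y \<mapsto> c - r/2 * \<parallel>y - x\<parallel>\<^sup>2\<close>; call \<open>r\<close> admissible for \<open>f\<close> if this happens for
  some vertex \<open>x\<close> and some \<open>c\<close>. The threshold is the infimum of the admissible \<open>r \<ge> 0\<close>.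

  The sum of two paraboloids of curvatures \<open>s\<close> and \<open>t\<close> with vertices \<open>a\<close> and \<open>b\<close> is, by completing
  the square, again a paraboloid: its curvature is \<open>s + t\<close> and its vertex is the weighted mean of
  \<open>a\<close> and \<open>b\<close> (if \<open>s = t = 0\<close>, both are constant). So if \<open>s\<close> is admissible for \<open>f1\<close> and \<open>t\<close> for \<open>f2\<close>, then \<open>s + t\<close> is admissible for
  \<open>f1 + f2\<close>, with no loss of an \<open>\<epsilon>\<close> in the curvature, and the bound on the threshold follows by
  taking infima over \<open>s\<close> and \<open>t\<close>.

  If \<open>m \<le> f2 \<le> M\<close>, then \<open>f1 + m \<le> f1 + f2\<close> and \<open>(f1 + f2) - M \<le> f1\<close>. Shifting the constant \<open>c\<close>
  of a paraboloid changes neither its curvature nor its vertex, so \<open>f1\<close> and \<open>f1 + f2\<close> have the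
  same admissible \<open>r\<close>, hence the same threshold.
\<close>

lemma moreau_envelope_gt_MInfty_iff:
  "moreau_envelope r f x > -\<infinity> \<longleftrightarrow> (\<exists>c::real. \<forall>y. ereal (c - r / 2 * (norm (y - x))\<^sup>2) \<le> f y)"
proof -
  have shift: "ereal c \<le> f y + ereal q \<longleftrightarrow> ereal (c - q) \<le> f y" for c q y
    by (cases "f y") auto
  have "moreau_envelope r f x > -\<infinity> \<longleftrightarrow> (\<exists>c::real. ereal c \<le> moreau_envelope r f x)"
    by (cases "moreau_envelope r f x") auto
  also have "\<dots> \<longleftrightarrow> (\<exists>c::real. \<forall>y. ereal (c - r / 2 * (norm (y - x))\<^sup>2) \<le> f y)"
    unfolding moreau_envelope_def le_INF_iff by (simp add: shift)
  finally show ?thesis .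
qed

lemma weighted_square_distances_complete_square:
  fixes a b y :: "'a::real_inner"
  assumes "s + t \<noteq> 0"
  defines "z \<equiv> (s *\<^sub>R a + t *\<^sub>R b) /\<^sub>R (s + t)"
  shows "s * (norm (y - a))\<^sup>2 + t * (norm (y - b))\<^sup>2 =
    (s + t) * (norm (y - z))\<^sup>2 + (s * (norm a)\<^sup>2 + t * (norm b)\<^sup>2 - (s + t) * (norm z)\<^sup>2)"
proof -
  have z: "(s + t) *\<^sub>R z = s *\<^sub>R a + t *\<^sub>R b"
    using assms by simp
  have expand: "(norm (y - v))\<^sup>2 = (norm y)\<^sup>2 - 2 * (y \<bullet> v) + (norm v)\<^sup>2" for v
    by (simp add: power2_norm_eq_inner inner_diff inner_commute)
  have "(s + t) * (y \<bullet> z) = s * (y \<bullet> a) + t * (y \<bullet> b)"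
    using arg_cong[OF z, of "\<lambda>v. y \<bullet> v"] by (simp add: inner_add_right)
  then show ?thesis
    unfolding expand by (simp add: algebra_simps)
qed

lemma moreau_envelope_add_gt_MInfty:
  fixes f g :: "'a::real_inner \<Rightarrow> ereal"
  assumes "s \<ge> 0" and "t \<ge> 0"
    and "moreau_envelope s f a > -\<infinity>" and "moreau_envelope t g b > -\<infinity>"
  shows "\<exists>z. moreau_envelope (s + t) (\<lambda>x. f x + g x) z > -\<infinity>"
proof -
  obtain c d :: real
    where c: "\<And>y. ereal (c - s / 2 * (norm (y - a))\<^sup>2) \<le> f y"
      and d: "\<And>y. ereal (d - t / 2 * (norm (y - b))\<^sup>2) \<le> g y"
    using assms(3,4) unfolding moreau_envelope_gt_MInfty_iff by blast
  obtain z k where zk: "\<And>y. s * (norm (y - a))\<^sup>2 + t * (norm (y - b))\<^sup>2 = (s + t) * (norm (y - z))\<^sup>2 + k"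
  proof (cases "s + t = 0")
    case True
    (* There is no weighted mean here, but both paraboloids are flat and any vertex will do. *)
    then have "s = 0" "t = 0"
      using assms(1,2) by linarith+
    then show ?thesis
      using that[of 0 0] by simp
  next
    case False
    then show ?thesis
      using that weighted_square_distances_complete_square by blast
  qed
  have "ereal (c + d - k / 2 - (s + t) / 2 * (norm (y - z))\<^sup>2) \<le> f y + g y" for y
  proof -
    have "c + d - k / 2 - (s + t) / 2 * (norm (y - z))\<^sup>2 =
        (c - s / 2 * (norm (y - a))\<^sup>2) + (d - t / 2 * (norm (y - b))\<^sup>2)"
      using zk[of y] by (simp add: field_simps)
    then show ?thesis
      using add_mono[OF c[of y] d[of y]] by (simp only: plus_ereal.simps(1))
  qed
  then show ?thesis
    unfolding moreau_envelope_gt_MInfty_iff by blast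
qed

lemma moreau_envelope_gt_MInfty_shift:
  assumes le: "\<And>y. f y + ereal k \<le> g y" and "moreau_envelope r f x > -\<infinity>"
  shows "moreau_envelope r g x > -\<infinity>"
proof -
  obtain c :: real where c: "\<And>y. ereal (c - r / 2 * (norm (y - x))\<^sup>2) \<le> f y"
    using assms(2) unfolding moreau_envelope_gt_MInfty_iff by blast
  have "ereal (c + k - r / 2 * (norm (y - x))\<^sup>2) \<le> g y" for y
    using order_trans[OF add_right_mono[OF c] le, of y] by (simp add: algebra_simps)
  then show ?thesis
    unfolding moreau_envelope_gt_MInfty_iff by blast
qed

lemma prox_threshold_le:
  assumes "r \<ge> 0" and "moreau_envelope r f x > -\<infinity>"
  shows "prox_threshold f \<le> r"
  unfolding prox_threshold_def
  by (rule cInf_lower) (use assms in \<open>auto intro: bdd_belowI[of _ 0]\<close>)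

lemma prox_threshold_greatest:
  assumes "prox_bounded f" and "\<And>r x. r \<ge> 0 \<Longrightarrow> moreau_envelope r f x > -\<infinity> \<Longrightarrow> l \<le> r"
  shows "l \<le> prox_threshold f"
  unfolding prox_threshold_def
  by (rule cInf_greatest) (use assms in \<open>auto simp: prox_bounded_def\<close>)

lemma prox_bounded_add:
  fixes f g :: "'a::real_inner \<Rightarrow> ereal"
  assumes "prox_bounded f" and "prox_bounded g"
  shows "prox_bounded (\<lambda>x. f x + g x)"
proof -
  obtain s a t b where "s \<ge> 0" "moreau_envelope s f a > -\<infinity>" "t \<ge> 0" "moreau_envelope t g b > -\<infinity>"
    using assms unfolding prox_bounded_def by blast
  then show ?thesis
    using moreau_envelope_add_gt_MInfty[of s t f a g b] add_nonneg_nonneg[of s t]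
    unfolding prox_bounded_def by blast
qed

lemma prox_threshold_add_le:
  fixes f g :: "'a::real_inner \<Rightarrow> ereal"
  assumes "prox_bounded f" and "prox_bounded g"
  shows "prox_threshold (\<lambda>x. f x + g x) \<le> prox_threshold f + prox_threshold g"
proof -
  let ?h = "\<lambda>x. f x + g x"
  have sum: "prox_threshold ?h \<le> s + t"
    if "s \<ge> 0" "moreau_envelope s f a > -\<infinity>" "t \<ge> 0" "moreau_envelope t g b > -\<infinity>" for s t a b
    using moreau_envelope_add_gt_MInfty[OF that(1,3,2,4)] that(1,3) prox_threshold_le[of "s + t" ?h]
    by auto
  have "prox_threshold ?h - s \<le> prox_threshold g"
    if "s \<ge> 0" "moreau_envelope s f a > -\<infinity>" for s a
    by (rule prox_threshold_greatest[OF assms(2)]) (use sum[OF that] in force)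
  then have "prox_threshold ?h - prox_threshold g \<le> prox_threshold f"
    by (intro prox_threshold_greatest[OF assms(1)]) force
  then show ?thesis
    by simp
qed

lemma prox_threshold_add_bounded:
  fixes f g :: "'a::real_normed_vector \<Rightarrow> ereal" and m M :: real
  assumes "\<And>x. ereal m \<le> g x" and "\<And>x. g x \<le> ereal M"
  shows "prox_threshold (\<lambda>x. f x + g x) = prox_threshold f"
proof -
  have "f y + ereal m \<le> f y + g y" for y
    using assms(1) by (rule add_left_mono)
  moreover have "(f y + g y) + ereal (- M) \<le> f y" for y
    using assms(1)[of y] assms(2)[of y] by (cases "f y"; cases "g y") auto
  ultimately have "moreau_envelope r (\<lambda>x. f x + g x) x > -\<infinity> \<longleftrightarrow> moreau_envelope r f x > -\<infinity>" for r x
    using moreau_envelope_gt_MInfty_shift[of f m "\<lambda>x. f x + g x"]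
      moreau_envelope_gt_MInfty_shift[of "\<lambda>x. f x + g x" "- M" f] by blast
  then show ?thesis
    unfolding prox_threshold_def by simp
qed

theorem proposition4p8:
  fixes f1 f2 f :: "'a::euclidean_space \<Rightarrow> ereal" and r1 r2 :: real
  assumes "proper_fun f1" and "lsc_fun f1" and "prox_bounded f1" and "prox_threshold f1 = r1"
    and "proper_fun f2" and "lsc_fun f2" and "prox_bounded f2" and "prox_threshold f2 = r2"
    and "\<And>x. f x = f1 x + f2 x"
  shows "prox_bounded f \<and> prox_threshold f \<le> r1 + r2 \<and>
    ((\<exists>m M :: real. \<forall>x. ereal m \<le> f2 x \<and> f2 x \<le> ereal M) \<longrightarrow> prox_threshold f = r1)"
proof -
  have f: "f = (\<lambda>x. f1 x + f2 x)"
    using assms(9) by blast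
  have "prox_threshold f = r1" if "\<forall>x. ereal m \<le> f2 x \<and> f2 x \<le> ereal M" for m M :: real
    using prox_threshold_add_bounded[of m f2 M f1] that assms(4) unfolding f by simp
  then show ?thesis
    using prox_bounded_add[OF assms(3,7)] prox_threshold_add_le[OF assms(3,7)] assms(4,8)
    unfolding f by blast
qed

end
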